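(* (Scenariowise maximum principle) For each $t=0,\dots,T$ let $$H_t(X_t,U_t,y_{t+1}):=L_t(X_t,U_t)+y_{t+1}\cdot(A_{t+1}X_t+B_{t+1}U_t),$$ $$\bar H_t(X_t,p_t,y_{t+1}):=\inf_{U_t\in\mathbb R^M}\{H_t(X_t,U_t,y_{t+1})-(X_t,U_t)\cdot p_t\}.$$ The conditions $$p_t-(\Delta y_{t+1}+A_{t+1}^*y_{t+1},\,B_{t+1}^*y_{t+1})\in\partial L_t(X_t,U_t)\ (t=0,\dots,T),\qquad \Delta X_t=A_tX_{t-1}+B_tU_{t-1}+W_t\ (t=1,\dots,T)\qquad\text{a.s.}$$ hold if and only if $(X,U)$ satisfies the system equations $\Delta X_t=A_tX_{t-1}+B_tU_{t-1}+W_t$, $t=1,\dots,T$, and, almost surely for all $t=0,\dots,T$, $$-(\Delta y_{t+1},0)\in\partial_{(X_t,U_t)}H_t(X_t,U_t,y_{t+1})-p_t.$$ This last inclusion is equivalent to $$U_t\in\operatorname*{argmin}_{U\in\mathbb R^M}\{H_t(X_t,U,y_{t+1})-(X_t,U)\cdot p_t\},\qquad -\Delta y_{t+1}\in\partial_{X_t}\bar H_t(X_t,p_t,y_{t+1}).$$ If, for all $(X_t,U_t,y_{t+1})\in\mathbb R^N\times\mathbb R^M\times\mathbb R^N$, $$\partial_{(X_t,U_t)}H_t(X_t,U_t,y_{t+1})=\partial_{X_t}H_t(X_t,U_t,y_{t+1})\times\partial_{U_t}H_t(X_t,U_t,y_{t+1}),\qquad(\ast)$$ then it is also equivalent to $$U_t\in\operatorname*{argmin}_{U\in\mathbb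 R^M}\{H_t(X_t,U,y_{t+1})-(X_t,U)\cdot p_t\},\qquad -\Delta y_{t+1}\in\partial_{X_t}\{H_t(X_t,U_t,y_{t+1})-(X_t,U_t)\cdot p_t\}$$ almost surely. Condition $(\ast)$ holds, in particular, if $L_t$ is of the form $L_t(X,U)=L_t^0(X,U)+L_t^1(X)+L_t^2(U)$, where $L_t^0$ is differentiable.
   Context: $(\Omega,\mathcal F,P)$ is a probability space with a filtration $(\mathcal F_t)_{t=0}^T$. $X=(X_t)_{t=0}^T$ and $U=(U_t)_{t=0}^T$ are adapted processes with values in $\mathbb R^N$ and $\mathbb R^M$; $p=(p_t)_{t=0}^T$ is an $\mathbb R^N\times\mathbb R^M$-valued and $y=(y_t)_{t=1}^T$ an $\mathbb R^N$-valued (not necessarily adapted) process. $A_t\in L^0(\mathbb R^{N\times N})$, $B_t\in L^0(\mathbb R^{N\times M})$, $W_t\in L^0(\mathbb R^N)$ are $\mathcal F_t$-measurable, and $A_t^*,B_t^*$ are scenariowise transposes. Conventions: $y_0:=0$, $y_{T+1}:=0$, $A_{T+1}:=0$, $B_{T+1}:=0$, $\Delta X_t:=X_t-X_{t-1}$, $\Delta y_{t+1}:=y_{t+1}-y_t$. $L_t$ are convex normal integrands on $\mathbb R^N\times\mathbb R^M\times\Omega$: $L_t(\cdot,\omega)$ is a closed convex extended real-valued function for every $\omega$ (closed: lower semicontinuous and either proper or constantly $\pm\infty$) and $\omega\mapsto\operatorname{epi}L_t(\cdot,\omega)$ is measurable. All subdifferentials are $\omega$-wise convex subdifferentials with respect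 to the indicated variables (the dependence on $\omega$ is suppressed), and are empty at points where the function is not finite. In the last sentence, $L_t^0$ is real-valued and $L_t^1,L_t^2$ take values in $(-\infty,+\infty]$. (The first displayed conditions are the scenariowise optimality (Karush–Kuhn–Tucker) conditions for the problem of minimizing $E\sum_{t=0}^TL_t(X_t,U_t)$ over adapted $(X,U)$ subject to $\Delta X_t=A_tX_{t-1}+B_tU_{t-1}+W_t$.) *)

theory Defs
  imports "HOL-Probability.Probability"
begin

definition epi :: "('e \<Rightarrow> ereal) \<Rightarrow> ('e \<times> real) set" where
  "epi f = {(z, r). f z \<le> ereal r}"

definition convex_fun :: "('e::real_vector \<Rightarrow> ereal) \<Rightarrow> bool" where
  "convex_fun f \<longleftrightarrow> convex (epi f)"

definition proper_fun :: "('e \<Rightarrow> ereal) \<Rightarrow> bool" where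
  "proper_fun f \<longleftrightarrow> (\<forall>z. f z \<noteq> -\<infinity>) \<and> (\<exists>z. f z \<noteq> \<infinity>)"

definition lsc_fun :: "('e::topological_space \<Rightarrow> ereal) \<Rightarrow> bool" where
  "lsc_fun f \<longleftrightarrow> (\<forall>z. f z \<le> Liminf (at z) f)"

definition closed_fun :: "('e::topological_space \<Rightarrow> ereal) \<Rightarrow> bool" where
  "closed_fun f \<longleftrightarrow>
     lsc_fun f \<and> (proper_fun f \<or> f = (\<lambda>z. \<infinity>) \<or> f = (\<lambda>z. -\<infinity>))"

definition subdifferential :: "('e::real_inner \<Rightarrow> ereal) \<Rightarrow> 'e \<Rightarrow> 'e set" where
  "subdifferential f z =
     {v. \<bar>f z\<bar> \<noteq> \<infinity> \<and> (\<forall>z'. f z + ereal (v \<bullet> (z' - z)) \<le> f z')}"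

definition argmin :: "('e \<Rightarrow> ereal) \<Rightarrow> 'e set" where
  "argmin f = {u. is_arg_min f (\<lambda>_. True) u}"

text \<open>Effros measurability of a set-valued mapping.\<close>

definition measurable_multifun :: "'a measure \<Rightarrow> ('a \<Rightarrow> 'e::topological_space set) \<Rightarrow> bool" where
  "measurable_multifun M S \<longleftrightarrow>
     (\<forall>G. open G \<longrightarrow> {\<omega> \<in> space M. S \<omega> \<inter> G \<noteq> {}} \<in> sets M)"

definition convex_normal_integrand ::
    "'a measure \<Rightarrow> ('a \<Rightarrow> 'e::real_normed_vector \<Rightarrow> ereal) \<Rightarrow> bool" where
  "convex_normal_integrand M f \<longleftrightarrow>
     (\<forall>\<omega>\<in>space M. closed_fun (f \<omega>) \<and> convex_fun (f \<omega>)) \<and>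
     measurable_multifun M (\<lambda>\<omega>. epi (f \<omega>))"

text \<open>Only used for \<open>t \<ge> 1\<close>, so that \<open>t - 1\<close> never truncates.\<close>

definition bdiff :: "(nat \<Rightarrow> 'a \<Rightarrow> 'v::ab_group_add) \<Rightarrow> nat \<Rightarrow> 'a \<Rightarrow> 'v" where
  "bdiff Z t \<omega> = Z t \<omega> - Z (t - 1) \<omega>"

definition system_eq ::
    "(nat \<Rightarrow> 'a \<Rightarrow> real^'n^'n) \<Rightarrow> (nat \<Rightarrow> 'a \<Rightarrow> real^'m^'n) \<Rightarrow> (nat \<Rightarrow> 'a \<Rightarrow> real^'n) \<Rightarrow>
     (nat \<Rightarrow> 'a \<Rightarrow> real^'n) \<Rightarrow> (nat \<Rightarrow> 'a \<Rightarrow> real^'m) \<Rightarrow> nat \<Rightarrow> 'a \<Rightarrow> bool" where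
  "system_eq A B W X U t \<omega> \<longleftrightarrow>
     bdiff X t \<omega> = A t \<omega> *v X (t - 1) \<omega> + B t \<omega> *v U (t - 1) \<omega> + W t \<omega>"

definition hamiltonian ::
    "(nat \<Rightarrow> 'a \<Rightarrow> (real^'n) \<times> (real^'m) \<Rightarrow> ereal) \<Rightarrow>
     (nat \<Rightarrow> 'a \<Rightarrow> real^'n^'n) \<Rightarrow> (nat \<Rightarrow> 'a \<Rightarrow> real^'m^'n) \<Rightarrow> nat \<Rightarrow> 'a \<Rightarrow>
     real^'n \<Rightarrow> real^'m \<Rightarrow> real^'n \<Rightarrow> ereal" where
  "hamiltonian L A B t \<omega> x u \<eta> =
     L t \<omega> (x, u) + ereal (\<eta> \<bullet> (A (Suc t) \<omega> *v x + B (Suc t) \<omega> *v u))"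

definition reduced_hamiltonian ::
    "(nat \<Rightarrow> 'a \<Rightarrow> (real^'n) \<times> (real^'m) \<Rightarrow> ereal) \<Rightarrow>
     (nat \<Rightarrow> 'a \<Rightarrow> real^'n^'n) \<Rightarrow> (nat \<Rightarrow> 'a \<Rightarrow> real^'m^'n) \<Rightarrow> nat \<Rightarrow> 'a \<Rightarrow>
     real^'n \<Rightarrow> (real^'n) \<times> (real^'m) \<Rightarrow> real^'n \<Rightarrow> ereal" where
  "reduced_hamiltonian L A B t \<omega> x q \<eta> =
     (INF u. hamiltonian L A B t \<omega> x u \<eta> - ereal ((x, u) \<bullet> q))"

definition hamiltonian_subdiff_product ::
    "(nat \<Rightarrow> 'a \<Rightarrow> (real^'n) \<times> (real^'m) \<Rightarrow> ereal) \<Rightarrow>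
     (nat \<Rightarrow> 'a \<Rightarrow> real^'n^'n) \<Rightarrow> (nat \<Rightarrow> 'a \<Rightarrow> real^'m^'n) \<Rightarrow> nat \<Rightarrow> 'a \<Rightarrow> bool" where
  "hamiltonian_subdiff_product L A B t \<omega> \<longleftrightarrow>
     (\<forall>x u \<eta>. subdifferential (\<lambda>(x', u'). hamiltonian L A B t \<omega> x' u' \<eta>) (x, u) =
        subdifferential (\<lambda>x'. hamiltonian L A B t \<omega> x' u \<eta>) x \<times>
        subdifferential (\<lambda>u'. hamiltonian L A B t \<omega> x u' \<eta>) u)"

definition kkt_inclusion where
  "kkt_inclusion L A B X U p y t \<omega> \<longleftrightarrow>
     p t \<omega> - (bdiff y (Suc t) \<omega> + transpose (A (Suc t) \<omega>) *v y (Suc t) \<omega>,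
              transpose (B (Suc t) \<omega>) *v y (Suc t) \<omega>)
       \<in> subdifferential (L t \<omega>) (X t \<omega>, U t \<omega>)"

definition hamiltonian_inclusion where
  "hamiltonian_inclusion L A B X U p y t \<omega> \<longleftrightarrow>
     - (bdiff y (Suc t) \<omega>, 0)
       \<in> (\<lambda>v. v - p t \<omega>) `
          subdifferential (\<lambda>(x, u). hamiltonian L A B t \<omega> x u (y (Suc t) \<omega>)) (X t \<omega>, U t \<omega>)"

definition control_minimizes where
  "control_minimizes L A B X U p y t \<omega> \<longleftrightarrow>
     U t \<omega> \<in> argmin (\<lambda>u. hamiltonian L A B t \<omega> (X t \<omega>) u (y (Suc t) \<omega>)
                          - ereal ((X t \<omega>, u) \<bullet> p t \<omega>))"

definition reduced_adjoint_inclusion where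
  "reduced_adjoint_inclusion L A B X p y t \<omega> \<longleftrightarrow>
     - bdiff y (Suc t) \<omega>
       \<in> subdifferential (\<lambda>x. reduced_hamiltonian L A B t \<omega> x (p t \<omega>) (y (Suc t) \<omega>)) (X t \<omega>)"

definition adjoint_inclusion where
  "adjoint_inclusion L A B X U p y t \<omega> \<longleftrightarrow>
     - bdiff y (Suc t) \<omega>
       \<in> subdifferential (\<lambda>x. hamiltonian L A B t \<omega> x (U t \<omega>) (y (Suc t) \<omega>)
                               - ereal ((x, U t \<omega>) \<bullet> p t \<omega>)) (X t \<omega>)"

end

(* The argument is scenariowise. Tilting a function by a linear form shifts its subdifferential, which turns the KKT inclusion into the Hamiltonian one. The inclusion
   says that (-Delta y, 0) is a subgradient of the tilted Hamiltonian, and the zero component means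
   exactly that the infimum over the controls is attained. For the separable case, convexity along
   the segment from (x,u) to (x',u') reduces the subgradient inequality to an infinitesimal one,
   where the mixed increment of the differentiable part is o(s). *)

theory Submission
  imports Defs
begin

section \<open>Subdifferentials under affine tilts, partial infima and restriction to one
  coordinate\<close>

text \<open>A finite affine term cancels from both sides of the subgradient inequality, up to the
  shift by its slope. The constant \<open>c\<close> makes room for the contribution of a variable
  that is held fixed.\<close>

lemma subdifferential_add_affine:
  "v \<in> subdifferential (\<lambda>z. f z + ereal (a \<bullet> z + c)) z \<longleftrightarrow> v - a \<in> subdifferential f z"
proof -
  have "f z + ereal (a \<bullet> z + c) + ereal (v \<bullet> (z' - z)) \<le> f z' + ereal (a \<bullet> z' + c)
      \<longleftrightarrow> f z + ereal ((v - a) \<bullet> (z' - z)) \<le> f z'" for z'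
    by (cases "f z"; cases "f z'") (auto simp: inner_simps algebra_simps)
  moreover have "\<bar>f z + ereal (a \<bullet> z + c)\<bar> \<noteq> \<infinity> \<longleftrightarrow> \<bar>f z\<bar> \<noteq> \<infinity>"
    by (cases "f z") auto
  ultimately show ?thesis
    unfolding subdifferential_def by simp
qed

text \<open>Finiteness is a separate clause because \<open>argmin\<close> also admits minimizers
  with infinite value, where the subdifferential is empty.\<close>

lemma zero_mem_subdifferential_iff:
  "0 \<in> subdifferential f z \<longleftrightarrow> \<bar>f z\<bar> \<noteq> \<infinity> \<and> z \<in> argmin f"
  by (auto simp: subdifferential_def argmin_def is_arg_min_def not_less zero_ereal_def[symmetric])

text \<open>With zero second component the lower bound in the subgradient inequality does not depend
  on \<open>u'\<close>, so it passes to the infimum over \<open>u'\<close>. At \<open>x' = x\<close>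
  it says that \<open>u\<close> attains this infimum, so the two functions agree at the base
  point.\<close>

lemma subdifferential_partial_infimum:
  "(v, 0) \<in> subdifferential f (x, u) \<longleftrightarrow>
     u \<in> argmin (\<lambda>u'. f (x, u')) \<and> v \<in> subdifferential (\<lambda>x'. INF u'. f (x', u')) x"
proof -
  have inf: "(INF u'. f (x, u')) = f (x, u)" if "\<forall>u'. f (x, u) \<le> f (x, u')"
    using that by (intro antisym INF_lower INF_greatest) auto
  have argmin_iff: "u \<in> argmin (\<lambda>u'. f (x, u')) \<longleftrightarrow> (\<forall>u'. f (x, u) \<le> f (x, u'))"
    by (auto simp: argmin_def is_arg_min_def not_less)
  show ?thesis
  proof
    assume l: "(v, 0) \<in> subdifferential f (x, u)"
    have ineq: "f (x, u) + ereal (v \<bullet> (x' - x)) \<le> f (x', u')" for x' u'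
      using l by (auto simp: subdifferential_def dest!: spec[of _ "x'"] spec[of _ "u'"])
    have "\<forall>u'. f (x, u) \<le> f (x, u')"
      using ineq[of x] by (simp add: zero_ereal_def[symmetric])
    with l ineq show "u \<in> argmin (\<lambda>u'. f (x, u')) \<and>
        v \<in> subdifferential (\<lambda>x'. INF u'. f (x', u')) x"
      by (auto simp: argmin_iff inf subdifferential_def intro!: INF_greatest)
  next
    assume r: "u \<in> argmin (\<lambda>u'. f (x, u')) \<and> v \<in> subdifferential (\<lambda>x'. INF u'. f (x', u')) x"
    \<comment> \<open>The reduced function is finite at \<open>x\<close>, and its value there is
      \<open>f (x, u)\<close> by minimality.\<close>
    then have fin: "\<bar>f (x, u)\<bar> \<noteq> \<infinity>"
      and le: "f (x, u) + ereal (v \<bullet> (x' - x)) \<le> (INF u'. f (x', u'))" for x'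
      by (auto simp: argmin_iff inf subdifferential_def)
    have "f (x, u) + ereal (v \<bullet> (x' - x)) \<le> f (x', u')" for x' u'
      using le[of x'] by (rule order_trans) (auto intro: INF_lower)
    with fin show "(v, 0) \<in> subdifferential f (x, u)"
      by (auto simp: subdifferential_def)
  qed
qed

text \<open>Vary one coordinate and keep the other. The reverse inclusion can fail: for
  \<open>\<bar>x - u\<bar>\<close> on the plane the left side at the origin is a diagonal segment,
  the right side a square.\<close>

lemma subdifferential_Pair_subset:
  "subdifferential f (x, u) \<subseteq>
     subdifferential (\<lambda>x'. f (x', u)) x \<times> subdifferential (\<lambda>u'. f (x, u')) u"
proof
  fix vw assume vw: "vw \<in> subdifferential f (x, u)"
  obtain v w where [simp]: "vw = (v, w)"
    by (cases vw)
  have ineq: "f (x, u) + ereal (v \<bullet> (x' - x) + w \<bullet> (u' - u)) \<le> f (x', u')" for x' u'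
    using vw by (auto simp: subdifferential_def dest!: spec[of _ "x'"] spec[of _ "u'"])
  show "vw \<in> subdifferential (\<lambda>x'. f (x', u)) x \<times> subdifferential (\<lambda>u'. f (x, u')) u"
    using vw ineq[of _ u] ineq[of x] by (auto simp: subdifferential_def)
qed

section \<open>Separable convex functions with a differentiable coupling term\<close>

text \<open>Real upper bounds \<open>r\<close> and \<open>s\<close> turn convexity of the epigraph
  into a chord bound free of extended-real arithmetic.\<close>

lemma convex_fun_segment_le:
  assumes "convex_fun f" "f a \<le> ereal r" "f b \<le> ereal s" "0 \<le> t" "t \<le> 1"
  shows "f (a + t *\<^sub>R (b - a)) \<le> ereal (r + t * (s - r))"
proof -
  have "(1 - t) *\<^sub>R (a, r) + t *\<^sub>R (b, s) \<in> epi f"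
    using assms by (intro convexD) (auto simp: convex_fun_def epi_def)
  then show ?thesis
    by (simp add: epi_def algebra_simps)
qed

text \<open>The first-order terms in the directions \<open>(d, e)\<close>, \<open>(d, 0)\<close> and
  \<open>(0, e)\<close> cancel by linearity of the derivative at the single point
  \<open>(x, u)\<close>.\<close>

lemma mixed_difference_quotient_tendsto_0:
  fixes g :: "'a::real_normed_vector \<times> 'b::real_normed_vector \<Rightarrow> real"
  assumes "g differentiable (at (x, u))"
  shows "((\<lambda>s. (g (x + s *\<^sub>R d, u + s *\<^sub>R e) - g (x + s *\<^sub>R d, u) - g (x, u + s *\<^sub>R e) + g (x, u)) / s)
           \<longlongrightarrow> 0) (at_right 0)"
proof -
  obtain D where D: "(g has_derivative D) (at (x, u))"
    using assms by (auto simp: differentiable_def)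
  interpret D: bounded_linear D
    using D by (rule has_derivative_bounded_linear)
  have dir: "((\<lambda>s. g (x + s *\<^sub>R a, u + s *\<^sub>R b)) has_real_derivative D (a, b)) (at 0)" for a b
  proof -
    have "((\<lambda>s::real. (x + s *\<^sub>R a, u + s *\<^sub>R b)) has_derivative (\<lambda>s. s *\<^sub>R (a, b))) (at 0)"
      by (auto intro!: derivative_eq_intros)
    from has_derivative_compose[OF this, of g D] D
    show ?thesis
      by (simp add: has_field_derivative_def D.scaleR mult_commute_abs del: scaleR_Pair)
  qed
  let ?R = "\<lambda>s. g (x + s *\<^sub>R d, u + s *\<^sub>R e) - g (x + s *\<^sub>R d, u) - g (x, u + s *\<^sub>R e) + g (x, u)"
  have "(?R has_real_derivative D (d, e) - D (d, 0) - D (0, e) + 0) (at 0)"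
    using dir[of d e] dir[of d 0] dir[of 0 e]
    by (intro DERIV_add DERIV_diff DERIV_const) simp_all
  moreover have "D (d, e) = D (d, 0) + D (0, e)"
    using D.add[of "(d, 0)" "(0, e)"] by simp
  ultimately have "(?R has_real_derivative 0) (at 0)"
    by simp
  \<comment> \<open>Since \<open>?R 0 = 0\<close>, this is the difference quotient of
    \<open>?R\<close> at 0.\<close>
  then have "((\<lambda>s. ?R s / s) \<longlongrightarrow> 0) (at 0)"
    by (simp add: DERIV_def)
  then show ?thesis
    by (rule tendsto_mono[rotated]) (simp add: at_le)
qed

text \<open>At a point of the segment towards \<open>(x', u')\<close>, the two partial subgradient
  inequalities together bound \<open>f\<close> from below up to the mixed increment of
  \<open>L0\<close>, while the chord bounds \<open>f\<close> from above. Dividing by the step length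
  and letting it tend to 0 removes that increment. Convexity is assumed of the sum \<open>f\<close>,
  not of its summands.\<close>

lemma subdifferential_Times_separable:
  fixes f :: "'a::real_inner \<times> 'b::real_inner \<Rightarrow> ereal"
  assumes conv: "convex_fun f"
    and diff: "L0 differentiable (at (x, u))"
    and L1: "\<And>x. L1 x \<noteq> -\<infinity>" and L2: "\<And>u. L2 u \<noteq> -\<infinity>"
    and f: "\<And>x u. f (x, u) = ereal (L0 (x, u)) + L1 x + L2 u"
  shows "subdifferential f (x, u) =
    subdifferential (\<lambda>x'. f (x', u)) x \<times> subdifferential (\<lambda>u'. f (x, u')) u"
proof (intro antisym subdifferential_Pair_subset subsetI, clarify)
  fix v w
  assume v: "v \<in> subdifferential (\<lambda>x'. f (x', u)) x"
    and w: "w \<in> subdifferential (\<lambda>u'. f (x, u')) u"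
  \<comment> \<open>Neither \<open>L1\<close> nor \<open>L2\<close> takes the value
    \<open>-\<infinity>\<close>, so a sum different from \<open>\<infinity>\<close> has only real
    summands.\<close>
  have finite_parts: "\<exists>a b. L1 x' = ereal a \<and> L2 u' = ereal b" if "f (x', u') \<noteq> \<infinity>" for x' u'
    using that L1[of x'] L2[of u'] by (cases "L1 x'"; cases "L2 u'") (auto simp: f)
  have fin: "\<bar>f (x, u)\<bar> \<noteq> \<infinity>"
    using v by (simp add: subdifferential_def)
  then have "f (x, u) \<noteq> \<infinity>"
    by auto
  then obtain a b where ab: "L1 x = ereal a" "L2 u = ereal b"
    using finite_parts by blast
  have "f (x, u) + ereal ((v, w) \<bullet> ((x', u') - (x, u))) \<le> f (x', u')" for x' u'
  proof (cases "f (x', u') = \<infinity>")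
    case False
    then obtain a' b' where ab': "L1 x' = ereal a'" "L2 u' = ereal b'"
      using finite_parts by blast
    let ?r = "L0 (x, u) + a + b" and ?r' = "L0 (x', u') + a' + b'"
    let ?d = "x' - x" and ?e = "u' - u"
    let ?R = "\<lambda>s. L0 (x + s *\<^sub>R ?d, u + s *\<^sub>R ?e) - L0 (x + s *\<^sub>R ?d, u) - L0 (x, u + s *\<^sub>R ?e) + L0 (x, u)"
    have step: "v \<bullet> ?d + w \<bullet> ?e + ?R s / s \<le> ?r' - ?r" if s: "0 < s" "s < 1" for s
    proof -
      have le: "f (x + s *\<^sub>R ?d, u + s *\<^sub>R ?e) \<le> ereal (?r + s * (?r' - ?r))"
        using convex_fun_segment_le[OF conv, of "(x, u)" ?r "(x', u')" ?r' s] s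
        by (simp add: f ab ab')
      \<comment> \<open>The finite chord bound makes \<open>L1\<close> and \<open>L2\<close> real at
        the intermediate point, so their values cancel when the three inequalities are
        added.\<close>
      then have "f (x + s *\<^sub>R ?d, u + s *\<^sub>R ?e) \<noteq> \<infinity>"
        by auto
      then obtain as bs where s_parts: "L1 (x + s *\<^sub>R ?d) = ereal as" "L2 (u + s *\<^sub>R ?e) = ereal bs"
        using finite_parts by blast
      have 1: "L0 (x + s *\<^sub>R ?d, u + s *\<^sub>R ?e) + as + bs \<le> ?r + s * (?r' - ?r)"
        using le by (simp add: f s_parts)
      have "f (x, u) + ereal (v \<bullet> (x + s *\<^sub>R ?d - x)) \<le> f (x + s *\<^sub>R ?d, u)"
        using v unfolding subdifferential_def by blast
      then have 2: "L0 (x, u) + a + s * (v \<bullet> ?d) \<le> L0 (x + s *\<^sub>R ?d, u) + as"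
        by (simp add: f s_parts ab)
      have "f (x, u) + ereal (w \<bullet> (u + s *\<^sub>R ?e - u)) \<le> f (x, u + s *\<^sub>R ?e)"
        using w unfolding subdifferential_def by blast
      then have 3: "L0 (x, u) + b + s * (w \<bullet> ?e) \<le> L0 (x, u + s *\<^sub>R ?e) + bs"
        by (simp add: f s_parts ab)
      \<comment> \<open>What survives the cancellation of \<open>as\<close> and \<open>bs\<close> is
        exactly the mixed increment \<open>?R s\<close>.\<close>
      have "s * (v \<bullet> ?d) + s * (w \<bullet> ?e) + ?R s \<le> s * (?r' - ?r)"
        using 1 2 3 by linarith
      then have "s * (v \<bullet> ?d + w \<bullet> ?e + ?R s / s) \<le> s * (?r' - ?r)"
        using s by (simp add: distrib_left[of s "v \<bullet> ?d + w \<bullet> ?e"] distrib_left[of s "v \<bullet> ?d"])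
      then show ?thesis
        using s by (simp only: mult_le_cancel_left_pos)
    qed
    have "((\<lambda>s. v \<bullet> ?d + w \<bullet> ?e + ?R s / s) \<longlongrightarrow> v \<bullet> ?d + w \<bullet> ?e + 0) (at_right 0)"
      by (intro tendsto_add tendsto_const mixed_difference_quotient_tendsto_0 diff)
    moreover have "\<forall>\<^sub>F s in at_right 0. v \<bullet> ?d + w \<bullet> ?e + ?R s / s \<le> ?r' - ?r"
      using step by (auto simp: eventually_at_right_field intro!: exI[of _ 1])
    ultimately have "v \<bullet> ?d + w \<bullet> ?e + 0 \<le> ?r' - ?r"
      by (rule tendsto_upperbound) simp
    then show ?thesis
      by (simp add: f ab ab')
  qed simp
  with fin show "(v, w) \<in> subdifferential f (x, u)"
    by (auto simp: subdifferential_def)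
qed

section \<open>Scenariowise forms of the Hamiltonian inclusion\<close>

text \<open>Transposition exhibits the Hamiltonian as \<open>L\<close> plus a linear form whose
  slope is the pair appearing in the KKT inclusion.\<close>

lemma hamiltonian_eq_tilt:
  "hamiltonian L A B t \<omega> x u \<eta> =
     L t \<omega> (x, u) + ereal ((transpose (A (Suc t) \<omega>) *v \<eta>, transpose (B (Suc t) \<omega>) *v \<eta>) \<bullet> (x, u))"
  by (simp add: hamiltonian_def inner_add_right dot_lmul_matrix transpose_matrix_vector)

lemma mem_subdifferential_hamiltonian:
  "v \<in> subdifferential (\<lambda>(x, u). hamiltonian L A B t \<omega> x u \<eta>) z \<longleftrightarrow>
     v - (transpose (A (Suc t) \<omega>) *v \<eta>, transpose (B (Suc t) \<omega>) *v \<eta>) \<in> subdifferential (L t \<omega>) z"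
  using subdifferential_add_affine[of v "L t \<omega>"
      "(transpose (A (Suc t) \<omega>) *v \<eta>, transpose (B (Suc t) \<omega>) *v \<eta>)" 0 z]
  by (simp add: hamiltonian_eq_tilt case_prod_unfold inner_prod_def)

text \<open>With \<open>u\<close> fixed, its share of the linear form is a constant; only the state
  part of the slope shifts the subdifferential.\<close>

lemma mem_subdifferential_hamiltonian_state:
  "v \<in> subdifferential (\<lambda>x. hamiltonian L A B t \<omega> x u \<eta>) x \<longleftrightarrow>
     v - transpose (A (Suc t) \<omega>) *v \<eta> \<in> subdifferential (\<lambda>x. L t \<omega> (x, u)) x"
  using subdifferential_add_affine[of v "\<lambda>x. L t \<omega> (x, u)" "transpose (A (Suc t) \<omega>) *v \<eta>"
      "(transpose (B (Suc t) \<omega>) *v \<eta>) \<bullet> u" x]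
  by (simp add: hamiltonian_eq_tilt)

lemma mem_subdifferential_hamiltonian_control:
  "w \<in> subdifferential (\<lambda>u. hamiltonian L A B t \<omega> x u \<eta>) u \<longleftrightarrow>
     w - transpose (B (Suc t) \<omega>) *v \<eta> \<in> subdifferential (\<lambda>u. L t \<omega> (x, u)) u"
  using subdifferential_add_affine[of w "\<lambda>u. L t \<omega> (x, u)" "transpose (B (Suc t) \<omega>) *v \<eta>"
      "(transpose (A (Suc t) \<omega>) *v \<eta>) \<bullet> x" u]
  by (simp add: hamiltonian_eq_tilt add.commute)

lemma hamiltonian_inclusion_iff:
  fixes p :: "nat \<Rightarrow> 'w \<Rightarrow> (real^'a) \<times> (real^'b)"
  shows "hamiltonian_inclusion L A B X U p y t \<omega> \<longleftrightarrow>
     p t \<omega> - (bdiff y (Suc t) \<omega>, 0)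
       \<in> subdifferential (\<lambda>(x, u). hamiltonian L A B t \<omega> x u (y (Suc t) \<omega>)) (X t \<omega>, U t \<omega>)"
proof -
  have "c \<in> (\<lambda>v. v - a) ` S \<longleftrightarrow> a + c \<in> S" for a c and S :: "((real^'a) \<times> (real^'b)) set"
    by (auto simp: image_iff intro!: bexI[of _ "a + c"])
  then show ?thesis
    unfolding hamiltonian_inclusion_def by (simp only: add_uminus_conv_diff)
qed

text \<open>Undoing the tilt subtracts the transposed terms from \<open>p - (\<Delta>y, 0)\<close>,
  which gives the vector of the KKT inclusion.\<close>

lemma kkt_inclusion_iff_hamiltonian_inclusion:
  "kkt_inclusion L A B X U p y t \<omega> \<longleftrightarrow> hamiltonian_inclusion L A B X U p y t \<omega>"
  unfolding kkt_inclusion_def hamiltonian_inclusion_iff mem_subdifferential_hamiltonian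
  by (simp add: diff_diff_eq)

lemma hamiltonian_inclusion_iff_reduced:
  "hamiltonian_inclusion L A B X U p y t \<omega> \<longleftrightarrow>
     control_minimizes L A B X U p y t \<omega> \<and> reduced_adjoint_inclusion L A B X p y t \<omega>"
proof -
  let ?H = "\<lambda>(x, u). hamiltonian L A B t \<omega> x u (y (Suc t) \<omega>)"
  \<comment> \<open>Tilting by \<open>- p\<close> moves \<open>p\<close> into the function, leaving
    a vector with zero control component as \<open>subdifferential_partial_infimum\<close> requires.
    The \<open>+ 0\<close> matches the affine term.\<close>
  have "(- bdiff y (Suc t) \<omega>, 0) \<in> subdifferential (\<lambda>z. ?H z + ereal ((- p t \<omega>) \<bullet> z + 0)) (X t \<omega>, U t \<omega>)
      \<longleftrightarrow> hamiltonian_inclusion L A B X U p y t \<omega>"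
    unfolding subdifferential_add_affine hamiltonian_inclusion_iff
    by (cases "p t \<omega>") simp
  then show ?thesis
    unfolding subdifferential_partial_infimum control_minimizes_def reduced_adjoint_inclusion_def
      reduced_hamiltonian_def
    by (simp add: minus_ereal_def inner_commute[of "p t \<omega>"])
qed

text \<open>The product structure splits the inclusion into a state part and a control part; the
  latter says that 0 is a subgradient of the tilted Hamiltonian in the control, that is, finiteness
  together with minimality.\<close>

lemma hamiltonian_inclusion_iff_adjoint:
  assumes "hamiltonian_subdiff_product L A B t \<omega>"
  shows "hamiltonian_inclusion L A B X U p y t \<omega> \<longleftrightarrow>
     control_minimizes L A B X U p y t \<omega> \<and> adjoint_inclusion L A B X U p y t \<omega>"
proof -
  let ?H = "\<lambda>x u. hamiltonian L A B t \<omega> x u (y (Suc t) \<omega>)"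
  obtain q r where p: "p t \<omega> = (q, r)"
    by (cases "p t \<omega>")
  have state: "adjoint_inclusion L A B X U p y t \<omega> \<longleftrightarrow>
      q - bdiff y (Suc t) \<omega> \<in> subdifferential (\<lambda>x. ?H x (U t \<omega>)) (X t \<omega>)"
    using subdifferential_add_affine[of "- bdiff y (Suc t) \<omega>" "\<lambda>x. ?H x (U t \<omega>)" "- q"
        "- (U t \<omega> \<bullet> r)" "X t \<omega>"]
    by (simp add: adjoint_inclusion_def p minus_ereal_def inner_commute[of q])
  have finite_iff: "\<bar>?H (X t \<omega>) (U t \<omega>) - ereal c\<bar> \<noteq> \<infinity> \<longleftrightarrow> \<bar>?H (X t \<omega>) (U t \<omega>)\<bar> \<noteq> \<infinity>" for c
    by (cases "?H (X t \<omega>) (U t \<omega>)") auto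
  have control: "r \<in> subdifferential (?H (X t \<omega>)) (U t \<omega>) \<longleftrightarrow>
      \<bar>?H (X t \<omega>) (U t \<omega>)\<bar> \<noteq> \<infinity> \<and> control_minimizes L A B X U p y t \<omega>"
  proof -
    have "(\<lambda>u. ?H (X t \<omega>) u - ereal ((X t \<omega>, u) \<bullet> p t \<omega>)) =
        (\<lambda>u. ?H (X t \<omega>) u + ereal ((- r) \<bullet> u + - (X t \<omega> \<bullet> q)))"
      by (simp add: fun_eq_iff p minus_ereal_def inner_commute[of r] algebra_simps)
    then have "r \<in> subdifferential (?H (X t \<omega>)) (U t \<omega>) \<longleftrightarrow>
        0 \<in> subdifferential (\<lambda>u. ?H (X t \<omega>) u - ereal ((X t \<omega>, u) \<bullet> p t \<omega>)) (U t \<omega>)"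
      by (simp only: subdifferential_add_affine) simp
    then show ?thesis
      unfolding zero_mem_subdifferential_iff finite_iff control_minimizes_def .
  qed
  have "hamiltonian_inclusion L A B X U p y t \<omega> \<longleftrightarrow>
      q - bdiff y (Suc t) \<omega> \<in> subdifferential (\<lambda>x. ?H x (U t \<omega>)) (X t \<omega>) \<and>
      r \<in> subdifferential (?H (X t \<omega>)) (U t \<omega>)"
    using assms by (simp add: hamiltonian_inclusion_iff hamiltonian_subdiff_product_def p)
  also have "\<dots> \<longleftrightarrow> adjoint_inclusion L A B X U p y t \<omega> \<and> control_minimizes L A B X U p y t \<omega>"
    \<comment> \<open>The finiteness clause of \<open>control\<close> is implied by the state
      inclusion, whose subdifferential is empty at infinite values.\<close>
    unfolding control state by (auto simp: subdifferential_def)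
  finally show ?thesis
    by blast
qed

text \<open>The tilt translates the joint subdifferential and each factor by matching components, so
  the product property passes from \<open>L\<close> to the Hamiltonian.\<close>

lemma hamiltonian_subdiff_product_separable:
  assumes "convex_fun (L t \<omega>)"
    and "\<And>z. L0 differentiable (at z)" "\<And>x. L1 x \<noteq> -\<infinity>" "\<And>u. L2 u \<noteq> -\<infinity>"
    and "\<And>x u. L t \<omega> (x, u) = ereal (L0 (x, u)) + L1 x + L2 u"
  shows "hamiltonian_subdiff_product L A B t \<omega>"
proof -
  have "subdifferential (L t \<omega>) (x, u) =
      subdifferential (\<lambda>x'. L t \<omega> (x', u)) x \<times> subdifferential (\<lambda>u'. L t \<omega> (x, u')) u" for x u
    using assms by (intro subdifferential_Times_separable[where ?L1.0 = L1 and ?L2.0 = L2])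
  then show ?thesis
    unfolding hamiltonian_subdiff_product_def
    by (auto simp: mem_subdifferential_hamiltonian mem_subdifferential_hamiltonian_state
        mem_subdifferential_hamiltonian_control)
qed

section \<open>From scenarios to almost sure equivalences\<close>

theorem mainTheorem15:
  fixes M :: "'a measure"
    and F :: "nat \<Rightarrow> 'a measure"
    and T :: nat
    and X :: "nat \<Rightarrow> 'a \<Rightarrow> real^'n"
    and U :: "nat \<Rightarrow> 'a \<Rightarrow> real^'m"
    and p :: "nat \<Rightarrow> 'a \<Rightarrow> (real^'n) \<times> (real^'m)"
    and y :: "nat \<Rightarrow> 'a \<Rightarrow> real^'n"
    and A :: "nat \<Rightarrow> 'a \<Rightarrow> real^'n^'n"
    and B :: "nat \<Rightarrow> 'a \<Rightarrow> real^'m^'n"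
    and W :: "nat \<Rightarrow> 'a \<Rightarrow> real^'n"
    and L :: "nat \<Rightarrow> 'a \<Rightarrow> (real^'n) \<times> (real^'m) \<Rightarrow> ereal"
  assumes "prob_space M"
    and "\<And>t. t \<le> T \<Longrightarrow> subalgebra M (F t)"
    and "\<And>s t. s \<le> t \<Longrightarrow> t \<le> T \<Longrightarrow> subalgebra (F t) (F s)"
    and "\<And>t. t \<le> T \<Longrightarrow> X t \<in> borel_measurable (F t)"
    and "\<And>t. t \<le> T \<Longrightarrow> U t \<in> borel_measurable (F t)"
    and "\<And>t. t \<le> T \<Longrightarrow> p t \<in> borel_measurable M"
    and "\<And>t. t \<in> {1..T} \<Longrightarrow> y t \<in> borel_measurable M"
    and "\<And>t. t \<in> {1..T} \<Longrightarrow> A t \<in> borel_measurable (F t)"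
    and "\<And>t. t \<in> {1..T} \<Longrightarrow> B t \<in> borel_measurable (F t)"
    and "\<And>t. t \<in> {1..T} \<Longrightarrow> W t \<in> borel_measurable (F t)"
    and "\<And>\<omega>. y 0 \<omega> = 0"
    and "\<And>\<omega>. y (Suc T) \<omega> = 0"
    and "\<And>\<omega>. A (Suc T) \<omega> = 0"
    and "\<And>\<omega>. B (Suc T) \<omega> = 0"
    and "\<And>t. t \<le> T \<Longrightarrow> convex_normal_integrand M (L t)"
  shows
    "((AE \<omega> in M. (\<forall>t\<le>T. kkt_inclusion L A B X U p y t \<omega>) \<and>
                   (\<forall>t\<in>{1..T}. system_eq A B W X U t \<omega>))
       \<longleftrightarrow> (AE \<omega> in M. \<forall>t\<in>{1..T}. system_eq A B W X U t \<omega>) \<and>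
           (AE \<omega> in M. \<forall>t\<le>T. hamiltonian_inclusion L A B X U p y t \<omega>))
     \<and> (\<forall>t\<le>T. \<forall>\<omega>\<in>space M.
          hamiltonian_inclusion L A B X U p y t \<omega> \<longleftrightarrow>
            control_minimizes L A B X U p y t \<omega> \<and> reduced_adjoint_inclusion L A B X p y t \<omega>)
     \<and> ((AE \<omega> in M. \<forall>t\<le>T. hamiltonian_inclusion L A B X U p y t \<omega>)
          \<longleftrightarrow> (AE \<omega> in M. \<forall>t\<le>T. control_minimizes L A B X U p y t \<omega> \<and>
                                  reduced_adjoint_inclusion L A B X p y t \<omega>))
     \<and> (\<forall>t\<le>T. \<forall>\<omega>\<in>space M. hamiltonian_subdiff_product L A B t \<omega> \<longrightarrow>
          (hamiltonian_inclusion L A B X U p y t \<omega> \<longleftrightarrow>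
            control_minimizes L A B X U p y t \<omega> \<and> adjoint_inclusion L A B X U p y t \<omega>))
     \<and> ((AE \<omega> in M. \<forall>t\<le>T. hamiltonian_subdiff_product L A B t \<omega>) \<longrightarrow>
          ((AE \<omega> in M. \<forall>t\<le>T. hamiltonian_inclusion L A B X U p y t \<omega>)
            \<longleftrightarrow> (AE \<omega> in M. \<forall>t\<le>T. control_minimizes L A B X U p y t \<omega> \<and>
                                    adjoint_inclusion L A B X U p y t \<omega>)))
     \<and> (\<forall>t\<le>T. \<forall>\<omega>\<in>space M.
          \<forall>(L0 :: (real^'n) \<times> (real^'m) \<Rightarrow> real) (L1 :: real^'n \<Rightarrow> ereal) (L2 :: real^'m \<Rightarrow> ereal).
            (\<forall>z. L0 differentiable (at z)) \<and> (\<forall>x. L1 x \<noteq> -\<infinity>) \<and> (\<forall>u. L2 u \<noteq> -\<infinity>) \<and>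
            (\<forall>x u. L t \<omega> (x, u) = ereal (L0 (x, u)) + L1 x + L2 u)
            \<longrightarrow> hamiltonian_subdiff_product L A B t \<omega>)"
proof (intro conjI allI impI ballI)
  show "(AE \<omega> in M. (\<forall>t\<le>T. kkt_inclusion L A B X U p y t \<omega>) \<and>
                   (\<forall>t\<in>{1..T}. system_eq A B W X U t \<omega>))
       \<longleftrightarrow> (AE \<omega> in M. \<forall>t\<in>{1..T}. system_eq A B W X U t \<omega>) \<and>
           (AE \<omega> in M. \<forall>t\<le>T. hamiltonian_inclusion L A B X U p y t \<omega>)"
    unfolding kkt_inclusion_iff_hamiltonian_inclusion AE_conj_iff by blast
next
  fix t \<omega>
  show "hamiltonian_inclusion L A B X U p y t \<omega> \<longleftrightarrow>
      control_minimizes L A B X U p y t \<omega> \<and> reduced_adjoint_inclusion L A B X p y t \<omega>"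
    by (rule hamiltonian_inclusion_iff_reduced)
next
  show "(AE \<omega> in M. \<forall>t\<le>T. hamiltonian_inclusion L A B X U p y t \<omega>)
      \<longleftrightarrow> (AE \<omega> in M. \<forall>t\<le>T. control_minimizes L A B X U p y t \<omega> \<and>
                              reduced_adjoint_inclusion L A B X p y t \<omega>)"
    unfolding hamiltonian_inclusion_iff_reduced ..
next
  fix t \<omega> assume "hamiltonian_subdiff_product L A B t \<omega>"
  then show "hamiltonian_inclusion L A B X U p y t \<omega> \<longleftrightarrow>
      control_minimizes L A B X U p y t \<omega> \<and> adjoint_inclusion L A B X U p y t \<omega>"
    by (rule hamiltonian_inclusion_iff_adjoint)
next
  assume "AE \<omega> in M. \<forall>t\<le>T. hamiltonian_subdiff_product L A B t \<omega>"
  \<comment> \<open>The product condition holds only almost surely, so the pointwise equivalence is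
    first obtained off a null set and then substituted under \<open>AE\<close>.\<close>
  then have "AE \<omega> in M. (\<forall>t\<le>T. hamiltonian_inclusion L A B X U p y t \<omega>) \<longleftrightarrow>
      (\<forall>t\<le>T. control_minimizes L A B X U p y t \<omega> \<and> adjoint_inclusion L A B X U p y t \<omega>)"
    by eventually_elim (simp add: hamiltonian_inclusion_iff_adjoint)
  then show "(AE \<omega> in M. \<forall>t\<le>T. hamiltonian_inclusion L A B X U p y t \<omega>)
      \<longleftrightarrow> (AE \<omega> in M. \<forall>t\<le>T. control_minimizes L A B X U p y t \<omega> \<and>
                              adjoint_inclusion L A B X U p y t \<omega>)"
    by (rule eventually_subst)
next
  fix t \<omega>
  fix L0 :: "(real^'n) \<times> (real^'m) \<Rightarrow> real" and L1 :: "real^'n \<Rightarrow> ereal" and L2 :: "real^'m \<Rightarrow> ereal"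
  assume "t \<le> T" "\<omega> \<in> space M"
    and sep: "(\<forall>z. L0 differentiable (at z)) \<and> (\<forall>x. L1 x \<noteq> -\<infinity>) \<and> (\<forall>u. L2 u \<noteq> -\<infinity>) \<and>
      (\<forall>x u. L t \<omega> (x, u) = ereal (L0 (x, u)) + L1 x + L2 u)"
  then have "convex_fun (L t \<omega>)"
    using assms(15) by (simp add: convex_normal_integrand_def)
  then show "hamiltonian_subdiff_product L A B t \<omega>"
    using sep by (intro hamiltonian_subdiff_product_separable[of L t \<omega> L0 L1 L2]) auto
qed

end
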